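(* Let $R$ and $V$ be rings, where $V$ is an $(R,R)$-bimodule that is also a ring such that $(vw)r=v(wr)$, $(vr)w=v(rw)$ and $(rv)w=r(vw)$ for all $v,w\in V$ and $r\in R$. Let $D(R,V)$ be the Dorroh extension of $R$ by $V$. Then: (1) If $D(R,V)$ is $\Delta$-quasipolar, then $R$ is $\Delta$-quasipolar. (2) If the following conditions are satisfied, then $D(R,V)$ is $\Delta$-quasipolar: (i) $R$ is $\Delta$-quasipolar; (ii) if $e\in R$ and $e^2=e$, then $ev=ve$ for all $v\in V$; (iii) if $v\in V$, then there exists $w\in V$ such that $v+w+vw=0$.
   Context: All rings are assumed to be unital and associative; $U(S)$ is the group of units of a ring $S$. The Dorroh extension $D(R,V)$ of $R$ by $V$ is the ring consisting of the additive abelian group $R\oplus V$ with multiplication $(r,v)(s,w)=(rs,\,rw+vs+vw)$ for $r,s\in R$, $v,w\in V$. For a ring $S$, $\Delta(S)=\{r\in S \mid r+u\in U(S)\text{ for all }u\in U(S)\}$. For $a\in S$, $comm(a)=\{x\in S\mid ax=xa\}$ and $comm^2(a)=\{y\in S\mid xy=yx\text{ for all }x\in comm(a)\}$. An element $a\in S$ is $\Delta$-quasipolar if there exists $p^2=p\in comm^2(a)$ such that $a+p\in\Delta(S)$; $S$ is $\Delta$-quasipolar if every element of $S$ is $\Delta$-quasipolar. *)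

theory Defs
  imports "HOL-Algebra.Ring"
begin

definition delta :: "('a, 'm) ring_scheme \<Rightarrow> 'a set"
  where "delta S = {r \<in> carrier S. \<forall>u \<in> Units S. r \<oplus>\<^bsub>S\<^esub> u \<in> Units S}"

definition commutant :: "('a, 'm) ring_scheme \<Rightarrow> 'a \<Rightarrow> 'a set"
  where "commutant S a = {x \<in> carrier S. a \<otimes>\<^bsub>S\<^esub> x = x \<otimes>\<^bsub>S\<^esub> a}"

definition double_commutant :: "('a, 'm) ring_scheme \<Rightarrow> 'a \<Rightarrow> 'a set"
  where "double_commutant S a =
    {y \<in> carrier S. \<forall>x \<in> commutant S a. x \<otimes>\<^bsub>S\<^esub> y = y \<otimes>\<^bsub>S\<^esub> x}"

definition delta_quasipolar_elem :: "('a, 'm) ring_scheme \<Rightarrow> 'a \<Rightarrow> bool"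
  where "delta_quasipolar_elem S a \<longleftrightarrow>
    (\<exists>p \<in> double_commutant S a. p \<otimes>\<^bsub>S\<^esub> p = p \<and> a \<oplus>\<^bsub>S\<^esub> p \<in> delta S)"

definition delta_quasipolar :: "('a, 'm) ring_scheme \<Rightarrow> bool"
  where "delta_quasipolar S \<longleftrightarrow> (\<forall>a \<in> carrier S. delta_quasipolar_elem S a)"

text \<open>
  Associative rings that need not have an identity. The field \<open>one\<close> of the record is
  unconstrained, so every \<^locale>\<open>ring\<close> is an instance.
\<close>

locale nonunital_ring = abelian_group V for V (structure) +
  assumes mult_closed: "\<lbrakk> v \<in> carrier V; w \<in> carrier V \<rbrakk> \<Longrightarrow> v \<otimes> w \<in> carrier V"
    and mult_assoc: "\<lbrakk> u \<in> carrier V; v \<in> carrier V; w \<in> carrier V \<rbrakk>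
      \<Longrightarrow> (u \<otimes> v) \<otimes> w = u \<otimes> (v \<otimes> w)"
    and mult_distr_left: "\<lbrakk> u \<in> carrier V; v \<in> carrier V; w \<in> carrier V \<rbrakk>
      \<Longrightarrow> (u \<oplus> v) \<otimes> w = u \<otimes> w \<oplus> v \<otimes> w"
    and mult_distr_right: "\<lbrakk> u \<in> carrier V; v \<in> carrier V; w \<in> carrier V \<rbrakk>
      \<Longrightarrow> u \<otimes> (v \<oplus> w) = u \<otimes> v \<oplus> u \<otimes> w"

lemma (in ring) nonunital_ring: "nonunital_ring R"
  by unfold_locales (auto simp: m_assoc l_distr r_distr)

text \<open>
  A (unital) bimodule over a possibly noncommutative ring \<open>R\<close>. Only the additive part of
  the record \<open>V\<close> is used.
\<close>

locale bimodule = ring R + V: abelian_group V for R (structure) and V (structure) +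
  fixes lact :: "'a \<Rightarrow> 'c \<Rightarrow> 'c" (infixr \<open>\<cdot>\<^sub>l\<close> 72)
    and ract :: "'c \<Rightarrow> 'a \<Rightarrow> 'c" (infixl \<open>\<cdot>\<^sub>r\<close> 72)
  assumes lact_closed: "\<lbrakk> r \<in> carrier R; v \<in> carrier V \<rbrakk> \<Longrightarrow> r \<cdot>\<^sub>l v \<in> carrier V"
    and ract_closed: "\<lbrakk> v \<in> carrier V; r \<in> carrier R \<rbrakk> \<Longrightarrow> v \<cdot>\<^sub>r r \<in> carrier V"
    and lact_add_scalar: "\<lbrakk> r \<in> carrier R; s \<in> carrier R; v \<in> carrier V \<rbrakk>
      \<Longrightarrow> (r \<oplus>\<^bsub>R\<^esub> s) \<cdot>\<^sub>l v = r \<cdot>\<^sub>l v \<oplus>\<^bsub>V\<^esub> s \<cdot>\<^sub>l v"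
    and lact_add: "\<lbrakk> r \<in> carrier R; v \<in> carrier V; w \<in> carrier V \<rbrakk>
      \<Longrightarrow> r \<cdot>\<^sub>l (v \<oplus>\<^bsub>V\<^esub> w) = r \<cdot>\<^sub>l v \<oplus>\<^bsub>V\<^esub> r \<cdot>\<^sub>l w"
    and lact_mult: "\<lbrakk> r \<in> carrier R; s \<in> carrier R; v \<in> carrier V \<rbrakk>
      \<Longrightarrow> (r \<otimes>\<^bsub>R\<^esub> s) \<cdot>\<^sub>l v = r \<cdot>\<^sub>l (s \<cdot>\<^sub>l v)"
    and lact_one: "v \<in> carrier V \<Longrightarrow> \<one>\<^bsub>R\<^esub> \<cdot>\<^sub>l v = v"
    and ract_add_scalar: "\<lbrakk> v \<in> carrier V; r \<in> carrier R; s \<in> carrier R \<rbrakk>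
      \<Longrightarrow> v \<cdot>\<^sub>r (r \<oplus>\<^bsub>R\<^esub> s) = v \<cdot>\<^sub>r r \<oplus>\<^bsub>V\<^esub> v \<cdot>\<^sub>r s"
    and ract_add: "\<lbrakk> v \<in> carrier V; w \<in> carrier V; r \<in> carrier R \<rbrakk>
      \<Longrightarrow> (v \<oplus>\<^bsub>V\<^esub> w) \<cdot>\<^sub>r r = v \<cdot>\<^sub>r r \<oplus>\<^bsub>V\<^esub> w \<cdot>\<^sub>r r"
    and ract_mult: "\<lbrakk> v \<in> carrier V; r \<in> carrier R; s \<in> carrier R \<rbrakk>
      \<Longrightarrow> v \<cdot>\<^sub>r (r \<otimes>\<^bsub>R\<^esub> s) = (v \<cdot>\<^sub>r r) \<cdot>\<^sub>r s"
    and ract_one: "v \<in> carrier V \<Longrightarrow> v \<cdot>\<^sub>r \<one>\<^bsub>R\<^esub> = v"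
    and lact_ract: "\<lbrakk> r \<in> carrier R; v \<in> carrier V; s \<in> carrier R \<rbrakk>
      \<Longrightarrow> (r \<cdot>\<^sub>l v) \<cdot>\<^sub>r s = r \<cdot>\<^sub>l (v \<cdot>\<^sub>r s)"

locale dorroh_bimodule = bimodule R V lact ract + V: nonunital_ring V
  for R (structure) and V (structure)
    and lact (infixr \<open>\<cdot>\<^sub>l\<close> 72) and ract (infixl \<open>\<cdot>\<^sub>r\<close> 72) +
  assumes mult_ract: "\<lbrakk> v \<in> carrier V; w \<in> carrier V; r \<in> carrier R \<rbrakk>
      \<Longrightarrow> (v \<otimes>\<^bsub>V\<^esub> w) \<cdot>\<^sub>r r = v \<otimes>\<^bsub>V\<^esub> (w \<cdot>\<^sub>r r)"
    and ract_mult_lact: "\<lbrakk> v \<in> carrier V; w \<in> carrier V; r \<in> carrier R \<rbrakk>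
      \<Longrightarrow> (v \<cdot>\<^sub>r r) \<otimes>\<^bsub>V\<^esub> w = v \<otimes>\<^bsub>V\<^esub> (r \<cdot>\<^sub>l w)"
    and lact_mult_ring: "\<lbrakk> v \<in> carrier V; w \<in> carrier V; r \<in> carrier R \<rbrakk>
      \<Longrightarrow> (r \<cdot>\<^sub>l v) \<otimes>\<^bsub>V\<^esub> w = r \<cdot>\<^sub>l (v \<otimes>\<^bsub>V\<^esub> w)"

definition dorroh ::
  "('a, 'm) ring_scheme \<Rightarrow> ('b, 'n) ring_scheme \<Rightarrow> ('a \<Rightarrow> 'b \<Rightarrow> 'b) \<Rightarrow> ('b \<Rightarrow> 'a \<Rightarrow> 'b)
    \<Rightarrow> ('a \<times> 'b) ring"
  where "dorroh R V lact ract =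
    \<lparr> carrier = carrier R \<times> carrier V,
      mult = (\<lambda>(r, v) (s, w).
        (r \<otimes>\<^bsub>R\<^esub> s, lact r w \<oplus>\<^bsub>V\<^esub> ract v s \<oplus>\<^bsub>V\<^esub> v \<otimes>\<^bsub>V\<^esub> w)),
      one = (\<one>\<^bsub>R\<^esub>, \<zero>\<^bsub>V\<^esub>),
      zero = (\<zero>\<^bsub>R\<^esub>, \<zero>\<^bsub>V\<^esub>),
      add = (\<lambda>(r, v) (s, w). (r \<oplus>\<^bsub>R\<^esub> s, v \<oplus>\<^bsub>V\<^esub> w)) \<rparr>"

context dorroh_bimodule
begin

lemma lact_zero: "r \<in> carrier R \<Longrightarrow> r \<cdot>\<^sub>l \<zero>\<^bsub>V\<^esub> = \<zero>\<^bsub>V\<^esub>"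
  by (metis V.add.l_cancel_one' V.r_zero V.zero_closed lact_add lact_closed)

lemma ract_zero: "r \<in> carrier R \<Longrightarrow> \<zero>\<^bsub>V\<^esub> \<cdot>\<^sub>r r = \<zero>\<^bsub>V\<^esub>"
  by (metis V.add.l_cancel_one' V.r_zero V.zero_closed ract_add ract_closed)

lemma mult_zero_left: "v \<in> carrier V \<Longrightarrow> \<zero>\<^bsub>V\<^esub> \<otimes>\<^bsub>V\<^esub> v = \<zero>\<^bsub>V\<^esub>"
  by (metis V.add.l_cancel_one' V.r_zero V.zero_closed V.mult_distr_left V.mult_closed)

lemma mult_zero_right: "v \<in> carrier V \<Longrightarrow> v \<otimes>\<^bsub>V\<^esub> \<zero>\<^bsub>V\<^esub> = \<zero>\<^bsub>V\<^esub>"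
  by (metis V.add.l_cancel_one' V.r_zero V.zero_closed V.mult_distr_right V.mult_closed)

lemmas closed_rules = lact_closed ract_closed V.mult_closed

lemma dorroh_ring: "ring (dorroh R V (\<cdot>\<^sub>l) (\<cdot>\<^sub>r))"
proof (rule ringI)
  show "abelian_group (dorroh R V (\<cdot>\<^sub>l) (\<cdot>\<^sub>r))"
  proof (rule abelian_groupI, goal_cases)
    case (6 x)
    then show ?case
      by (intro bexI[of _ "(\<ominus>\<^bsub>R\<^esub> fst x, \<ominus>\<^bsub>V\<^esub> snd x)"])
        (auto simp: dorroh_def l_neg V.l_neg)
  qed (auto simp: dorroh_def a_ac V.a_ac)
next
  show "monoid (dorroh R V (\<cdot>\<^sub>l) (\<cdot>\<^sub>r))"
    by (rule monoidI)
      (auto simp: dorroh_def closed_rules m_assoc lact_add ract_add lact_mult ract_mult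
        lact_ract lact_one ract_one lact_zero ract_zero mult_zero_left mult_zero_right
        V.mult_assoc V.mult_distr_left V.mult_distr_right mult_ract ract_mult_lact
        lact_mult_ring V.a_ac)
qed (auto simp: dorroh_def closed_rules l_distr r_distr lact_add ract_add lact_add_scalar
      ract_add_scalar V.mult_distr_left V.mult_distr_right V.a_ac)

end

end

theory Submission
  imports Defs
begin

text \<open>
  Both parts rest on comparing units: the projection \<open>D(R,V) \<rightarrow> R\<close> and the
  embedding \<open>r \<mapsto> (r, 0)\<close> preserve units, and under (iii) the projection also reflects them,
  because \<open>(g, z) = (g, 0)(1, g\<^sup>-\<^sup>1z)\<close>. For (1) the first component of an idempotent that serves
  \<open>(r, 0)\<close> serves \<open>r\<close>; for (2), if \<open>p\<close> serves \<open>r\<close> then \<open>(p, 0)\<close> serves \<open>(r, v)\<close>, where (ii)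
  puts it in the double commutant.
\<close>

context dorroh_bimodule
begin

abbreviation dorroh_extension :: "('a \<times> 'c) ring" (\<open>\<D>\<close>)
  where "\<D> \<equiv> dorroh R V (\<cdot>\<^sub>l) (\<cdot>\<^sub>r)"

lemma dorroh_carrier [simp]: "carrier \<D> = carrier R \<times> carrier V"
  and dorroh_mult [simp]: "(r, v) \<otimes>\<^bsub>\<D>\<^esub> (s, w) =
    (r \<otimes>\<^bsub>R\<^esub> s, r \<cdot>\<^sub>l w \<oplus>\<^bsub>V\<^esub> v \<cdot>\<^sub>r s \<oplus>\<^bsub>V\<^esub> v \<otimes>\<^bsub>V\<^esub> w)"
  and dorroh_one [simp]: "\<one>\<^bsub>\<D>\<^esub> = (\<one>\<^bsub>R\<^esub>, \<zero>\<^bsub>V\<^esub>)"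
  and dorroh_add [simp]: "(r, v) \<oplus>\<^bsub>\<D>\<^esub> (s, w) = (r \<oplus>\<^bsub>R\<^esub> s, v \<oplus>\<^bsub>V\<^esub> w)"
  by (simp_all add: dorroh_def)

lemma dorroh_unit_fst:
  assumes "(u, v) \<in> Units \<D>"
  shows "u \<in> Units R"
  using assms by (auto simp: Units_def)

text \<open>On pairs with second component zero, all three summands in the second component of a
  product vanish, so \<open>(inv u, \<zero>)\<close> inverts \<open>(u, \<zero>)\<close>.\<close>

lemma dorroh_unit_embed:
  assumes "u \<in> Units R"
  shows "(u, \<zero>\<^bsub>V\<^esub>) \<in> Units \<D>"
proof -
  have "(u, \<zero>\<^bsub>V\<^esub>) \<otimes>\<^bsub>\<D>\<^esub> (inv\<^bsub>R\<^esub> u, \<zero>\<^bsub>V\<^esub>) = \<one>\<^bsub>\<D>\<^esub>"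
    "(inv\<^bsub>R\<^esub> u, \<zero>\<^bsub>V\<^esub>) \<otimes>\<^bsub>\<D>\<^esub> (u, \<zero>\<^bsub>V\<^esub>) = \<one>\<^bsub>\<D>\<^esub>"
    "(u, \<zero>\<^bsub>V\<^esub>) \<in> carrier \<D>" "(inv\<^bsub>R\<^esub> u, \<zero>\<^bsub>V\<^esub>) \<in> carrier \<D>"
    using assms by (simp_all add: Units_closed lact_zero ract_zero mult_zero_left)
  then show ?thesis
    unfolding Units_def by blast
qed

text \<open>Since (1, v)(1, w) = (1, v + w + vw), condition (iii) gives each element (1, v) a right
  inverse of the same shape. That inverse has a right inverse in turn, which forces both to be
  two-sided.\<close>

lemma dorroh_unit_one:
  assumes quasi_inv: "\<forall>v \<in> carrier V. \<exists>w \<in> carrier V. v \<oplus>\<^bsub>V\<^esub> w \<oplus>\<^bsub>V\<^esub> v \<otimes>\<^bsub>V\<^esub> w = \<zero>\<^bsub>V\<^esub>"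
    and y: "y \<in> carrier V"
  shows "(\<one>\<^bsub>R\<^esub>, y) \<in> Units \<D>"
proof -
  interpret D: ring \<D> by (rule dorroh_ring)
  have right_inv: "\<exists>w \<in> carrier V. (\<one>\<^bsub>R\<^esub>, v) \<otimes>\<^bsub>\<D>\<^esub> (\<one>\<^bsub>R\<^esub>, w) = \<one>\<^bsub>\<D>\<^esub>"
    if v: "v \<in> carrier V" for v
  proof -
    obtain w where w: "w \<in> carrier V" "v \<oplus>\<^bsub>V\<^esub> w \<oplus>\<^bsub>V\<^esub> v \<otimes>\<^bsub>V\<^esub> w = \<zero>\<^bsub>V\<^esub>"
      using quasi_inv v by blast
    \<comment> \<open>The product formula lists the summands as w + v + vw, hence the explicit
      instance of commutativity.\<close>
    then have "(\<one>\<^bsub>R\<^esub>, v) \<otimes>\<^bsub>\<D>\<^esub> (\<one>\<^bsub>R\<^esub>, w) = \<one>\<^bsub>\<D>\<^esub>"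
      using v by (simp add: lact_one ract_one V.a_comm[of w v])
    then show ?thesis
      using w(1) by blast
  qed
  obtain w where w: "w \<in> carrier V" "(\<one>\<^bsub>R\<^esub>, y) \<otimes>\<^bsub>\<D>\<^esub> (\<one>\<^bsub>R\<^esub>, w) = \<one>\<^bsub>\<D>\<^esub>"
    using right_inv[OF y] by blast
  obtain z where z: "z \<in> carrier V" "(\<one>\<^bsub>R\<^esub>, w) \<otimes>\<^bsub>\<D>\<^esub> (\<one>\<^bsub>R\<^esub>, z) = \<one>\<^bsub>\<D>\<^esub>"
    using right_inv[OF w(1)] by blast
  have carr: "(\<one>\<^bsub>R\<^esub>, y) \<in> carrier \<D>" "(\<one>\<^bsub>R\<^esub>, w) \<in> carrier \<D>" "(\<one>\<^bsub>R\<^esub>, z) \<in> carrier \<D>"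
    using y w(1) z(1) by simp_all
  \<comment> \<open>The element (1, w) has left inverse (1, y) and right inverse (1, z), so the two
    coincide.\<close>
  have "(\<one>\<^bsub>R\<^esub>, y) = (\<one>\<^bsub>R\<^esub>, z)"
    using D.inv_unique[OF w(2) z(2) carr(2,1,3)] .
  then have "(\<one>\<^bsub>R\<^esub>, w) \<otimes>\<^bsub>\<D>\<^esub> (\<one>\<^bsub>R\<^esub>, y) = \<one>\<^bsub>\<D>\<^esub>"
    using z(2) by (simp only:)
  then show ?thesis
    unfolding Units_def using w(2) carr(1,2) by blast
qed

text \<open>This makes being a unit a condition on the first component alone, so the Delta condition
  lifts from R whatever the second components are.\<close>

lemma dorroh_unit_iff:
  assumes quasi_inv: "\<forall>v \<in> carrier V. \<exists>w \<in> carrier V. v \<oplus>\<^bsub>V\<^esub> w \<oplus>\<^bsub>V\<^esub> v \<otimes>\<^bsub>V\<^esub> w = \<zero>\<^bsub>V\<^esub>"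
    and z: "z \<in> carrier V"
  shows "(g, z) \<in> Units \<D> \<longleftrightarrow> g \<in> Units R"
proof
  assume g: "g \<in> Units R"
  interpret D: ring \<D> by (rule dorroh_ring)
  let ?y = "inv\<^bsub>R\<^esub> g \<cdot>\<^sub>l z"
  have y: "?y \<in> carrier V"
    using g z by (simp add: lact_closed)
  have "g \<cdot>\<^sub>l ?y = z"
    using g z lact_mult[of g "inv\<^bsub>R\<^esub> g" z] by (simp add: Units_closed lact_one)
  then have "(g, z) = (g, \<zero>\<^bsub>V\<^esub>) \<otimes>\<^bsub>\<D>\<^esub> (\<one>\<^bsub>R\<^esub>, ?y)"
    using g y z by (simp add: Units_closed ract_zero mult_zero_left)
  then show "(g, z) \<in> Units \<D>"
    using D.Units_m_closed[OF dorroh_unit_embed[OF g] dorroh_unit_one[OF quasi_inv y]] by simp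
qed (rule dorroh_unit_fst)

lemma delta_quasipolar_base:
  assumes "delta_quasipolar \<D>"
  shows "delta_quasipolar R"
  unfolding delta_quasipolar_def delta_quasipolar_elem_def
proof
  fix r assume r: "r \<in> carrier R"
  then have "delta_quasipolar_elem \<D> (r, \<zero>\<^bsub>V\<^esub>)"
    using assms by (simp add: delta_quasipolar_def)
  then obtain p q where pq: "(p, q) \<in> double_commutant \<D> (r, \<zero>\<^bsub>V\<^esub>)"
    and idem: "(p, q) \<otimes>\<^bsub>\<D>\<^esub> (p, q) = (p, q)"
    and del: "(r, \<zero>\<^bsub>V\<^esub>) \<oplus>\<^bsub>\<D>\<^esub> (p, q) \<in> delta \<D>"
    by (auto simp: delta_quasipolar_elem_def)
  have p: "p \<in> carrier R"
    using pq by (simp add: double_commutant_def)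
  have "x \<otimes>\<^bsub>R\<^esub> p = p \<otimes>\<^bsub>R\<^esub> x" if "x \<in> commutant R r" for x
  proof -
    have "(x, \<zero>\<^bsub>V\<^esub>) \<in> commutant \<D> (r, \<zero>\<^bsub>V\<^esub>)"
      using that r by (simp add: commutant_def lact_zero ract_zero)
    \<comment> \<open>Comparing first components in this equation gives xp = px.\<close>
    then have "(x, \<zero>\<^bsub>V\<^esub>) \<otimes>\<^bsub>\<D>\<^esub> (p, q) = (p, q) \<otimes>\<^bsub>\<D>\<^esub> (x, \<zero>\<^bsub>V\<^esub>)"
      using pq by (simp only: double_commutant_def mem_Collect_eq)
    then show ?thesis by simp
  qed
  then have "p \<in> double_commutant R r"
    using p by (simp add: double_commutant_def)
  moreover have "p \<otimes>\<^bsub>R\<^esub> p = p"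
    using idem by simp
  moreover have "r \<oplus>\<^bsub>R\<^esub> p \<in> delta R"
    unfolding delta_def
  proof (intro CollectI conjI ballI)
    fix u assume "u \<in> Units R"
    \<comment> \<open>The unit u is tested through its image (u, 0) in the extension; projecting the
      resulting unit yields r + p + u.\<close>
    then have "(r, \<zero>\<^bsub>V\<^esub>) \<oplus>\<^bsub>\<D>\<^esub> (p, q) \<oplus>\<^bsub>\<D>\<^esub> (u, \<zero>\<^bsub>V\<^esub>) \<in> Units \<D>"
      using del dorroh_unit_embed by (simp only: delta_def mem_Collect_eq)
    then show "r \<oplus>\<^bsub>R\<^esub> p \<oplus>\<^bsub>R\<^esub> u \<in> Units R"
      by (auto dest: dorroh_unit_fst)
  qed (use r p in simp)
  ultimately show "\<exists>p \<in> double_commutant R r. p \<otimes>\<^bsub>R\<^esub> p = p \<and> r \<oplus>\<^bsub>R\<^esub> p \<in> delta R"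
    by blast
qed

lemma delta_quasipolar_dorroh:
  assumes qp: "delta_quasipolar R"
    and idem_central: "\<forall>e \<in> carrier R. e \<otimes>\<^bsub>R\<^esub> e = e \<longrightarrow> (\<forall>v \<in> carrier V. e \<cdot>\<^sub>l v = v \<cdot>\<^sub>r e)"
    and quasi_inv: "\<forall>v \<in> carrier V. \<exists>w \<in> carrier V. v \<oplus>\<^bsub>V\<^esub> w \<oplus>\<^bsub>V\<^esub> v \<otimes>\<^bsub>V\<^esub> w = \<zero>\<^bsub>V\<^esub>"
  shows "delta_quasipolar \<D>"
  unfolding delta_quasipolar_def
proof
  fix a assume "a \<in> carrier \<D>"
  then obtain r v where a: "a = (r, v)" and r: "r \<in> carrier R" and v: "v \<in> carrier V"
    by auto
  obtain p where dc: "p \<in> double_commutant R r" and idem: "p \<otimes>\<^bsub>R\<^esub> p = p"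
    and del: "r \<oplus>\<^bsub>R\<^esub> p \<in> delta R"
    using qp r by (auto simp: delta_quasipolar_def delta_quasipolar_elem_def)
  have p: "p \<in> carrier R"
    using dc by (simp add: double_commutant_def)
  have "(p, \<zero>\<^bsub>V\<^esub>) \<in> double_commutant \<D> (r, v)"
    unfolding double_commutant_def
  proof (intro CollectI conjI ballI)
    fix b assume "b \<in> commutant \<D> (r, v)"
    \<comment> \<open>First components multiply as in R, so an element commuting with (r, v) has
      first component commuting with r.\<close>
    then obtain x y where b: "b = (x, y)" "y \<in> carrier V" and x: "x \<in> commutant R r"
      by (auto simp: commutant_def)
    have "x \<otimes>\<^bsub>R\<^esub> p = p \<otimes>\<^bsub>R\<^esub> x" "x \<in> carrier R"
      using dc x by (auto simp: double_commutant_def commutant_def)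
    \<comment> \<open>The second components of b(p, 0) and (p, 0)b reduce to yp and py; condition
      (ii) equates them because p is idempotent.\<close>
    moreover have "p \<cdot>\<^sub>l y = y \<cdot>\<^sub>r p"
      using idem_central p idem b(2) by blast
    ultimately show "b \<otimes>\<^bsub>\<D>\<^esub> (p, \<zero>\<^bsub>V\<^esub>) = (p, \<zero>\<^bsub>V\<^esub>) \<otimes>\<^bsub>\<D>\<^esub> b"
      using p b by (simp add: lact_zero ract_zero mult_zero_left mult_zero_right ract_closed)
  qed (use p in simp)
  moreover have "(p, \<zero>\<^bsub>V\<^esub>) \<otimes>\<^bsub>\<D>\<^esub> (p, \<zero>\<^bsub>V\<^esub>) = (p, \<zero>\<^bsub>V\<^esub>)"
    using p idem by (simp add: lact_zero ract_zero mult_zero_left)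
  moreover have "(r, v) \<oplus>\<^bsub>\<D>\<^esub> (p, \<zero>\<^bsub>V\<^esub>) \<in> delta \<D>"
    unfolding delta_def
  proof (intro CollectI conjI ballI)
    fix c assume unit: "c \<in> Units \<D>"
    obtain u w where c: "c = (u, w)"
      by (cases c)
    have u: "u \<in> Units R"
      using unit unfolding c by (rule dorroh_unit_fst)
    have w: "w \<in> carrier V"
      using unit by (simp add: c Units_def)
    \<comment> \<open>This is the first component of (r, v) + (p, 0) + c, which by
      \<open>dorroh_unit_iff\<close> decides whether the sum is a unit.\<close>
    have "r \<oplus>\<^bsub>R\<^esub> p \<oplus>\<^bsub>R\<^esub> u \<in> Units R"
      using del u by (simp add: delta_def)
    then show "(r, v) \<oplus>\<^bsub>\<D>\<^esub> (p, \<zero>\<^bsub>V\<^esub>) \<oplus>\<^bsub>\<D>\<^esub> c \<in> Units \<D>"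
      using v w by (simp add: c dorroh_unit_iff[OF quasi_inv])
  qed (use r v p in simp)
  ultimately show "delta_quasipolar_elem \<D> a"
    unfolding delta_quasipolar_elem_def a by blast
qed

end

theorem theorem2p24:
  fixes R :: "('a, 'm) ring_scheme"
    and V :: "('b, 'n) ring_scheme"
    and lact :: "'a \<Rightarrow> 'b \<Rightarrow> 'b" (infixr \<open>\<cdot>\<^sub>l\<close> 72)
    and ract :: "'b \<Rightarrow> 'a \<Rightarrow> 'b" (infixl \<open>\<cdot>\<^sub>r\<close> 72)
  assumes "dorroh_bimodule R V (\<cdot>\<^sub>l) (\<cdot>\<^sub>r)"
  shows "(delta_quasipolar (dorroh R V (\<cdot>\<^sub>l) (\<cdot>\<^sub>r)) \<longrightarrow> delta_quasipolar R) \<and>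
    (delta_quasipolar R \<and>
     (\<forall>e \<in> carrier R. e \<otimes>\<^bsub>R\<^esub> e = e \<longrightarrow> (\<forall>v \<in> carrier V. e \<cdot>\<^sub>l v = v \<cdot>\<^sub>r e)) \<and>
     (\<forall>v \<in> carrier V. \<exists>w \<in> carrier V. v \<oplus>\<^bsub>V\<^esub> w \<oplus>\<^bsub>V\<^esub> v \<otimes>\<^bsub>V\<^esub> w = \<zero>\<^bsub>V\<^esub>)
     \<longrightarrow> delta_quasipolar (dorroh R V (\<cdot>\<^sub>l) (\<cdot>\<^sub>r)))"
proof -
  interpret dorroh_bimodule R V "(\<cdot>\<^sub>l)" "(\<cdot>\<^sub>r)" by (fact assms)
  show ?thesis
    by (intro conjI impI; (elim conjE)?)
      (rule delta_quasipolar_base delta_quasipolar_dorroh; assumption)+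
qed

end
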